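(* Let $(X,d)$ be a bounded Lorentzian-metric space that includes $i^0$, and let $\tau\colon X\to\mathbb{R}$ be a time function. Let $\sigma_n\colon[a_n,b_n]\to X$ be a sequence of isocausal curves parametrized with respect to $\tau$, i.e. $\tau(\sigma_n(t))=t$ for all $t\in[a_n,b_n]$. Suppose that the sequences $\{a_n\}$ and $\{b_n\}$ have no accumulation point in common. Then there exist an isocausal curve $\sigma\colon[a,b]\to X$ and a subsequence $\{\sigma_{n_k}\}_k$ that converges uniformly to $\sigma$. If the curves $\sigma_n$ are maximizing, then so is $\sigma$.
   Context: A bounded Lorentzian-metric space $(X,d)$ is a set $X$ with a map $d\colon X\times X\to[0,\infty)$ such that: (i) if $d(x,y)>0$ and $d(y,z)>0$ then $d(x,z)\ge d(x,y)+d(y,z)$; (ii) there is a topology $T$ on $X$ such that $d$ is continuous for $T\times T$ and for every $\epsilon>0$ the set $\{(p,q): d(p,q)\ge\epsilon\}$ is compact for $T\times T$; (iii) for every $x\ne y$ there is $z$ with $d(x,z)\ne d(y,z)$ or $d(z,x)\ne d(z,y)$. The topology $\mathscr{T}$ of $(X,d)$ is the intersection of all topologies $T$ as in (ii); topological notions on $X$ refer to $\mathscr{T}$. The space includes $i^0$ if there is a (necessarily unique) point $i^0\in X$ with $d(i^0,p)=d(p,i^0)=0$ for all $p\in X$; in this case $(X,\mathscr{T})$ is compact and metrizable. Write $x\le y$ if for all $p\in X$, $d(p,y)\ge d(p,x)$ and $d(x,p)\ge d(y,p)$; write $x<y$ if $x\le y$ and $x\neq y$. A time function is a continuous function $\tau\colon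 X\to\mathbb{R}$ with $\tau(x)<\tau(y)$ whenever $x<y$. A continuous curve $\sigma\colon[a,b]\to X$ is isocausal if $\sigma(t)<\sigma(t')$ whenever $t<t'$. It is maximal (maximizing) if $d(\sigma(t),\sigma(t'))+d(\sigma(t'),\sigma(t''))=d(\sigma(t),\sigma(t''))$ for all $t<t'<t''$ in $[a,b]$. For an isocausal curve $\sigma\colon[a,b]\to X$ let $\hat\sigma\colon\mathbb{R}\to X$ be its extension by the constant $\sigma(a)$ for $s<a$ and the constant $\sigma(b)$ for $s>b$. One says that $\sigma_n\colon[a_n,b_n]\to X$ converges uniformly to $\sigma\colon[a,b]\to X$ if $a_n\to a$, $b_n\to b$ and $\hat\sigma_n\to\hat\sigma$ uniformly on $\mathbb{R}$ with respect to a metric inducing $\mathscr{T}$ (the choice is immaterial since $X$ is compact; one may use $\gamma(x,y)=\max(\sup_{z}|d(x,z)-d(y,z)|,\sup_z|d(z,x)-d(z,y)|)$). An accumulation point of a real sequence means the limit of some subsequence. *)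

theory Defs
  imports "HOL-Analysis.Analysis"
begin

definition Lorentzian_admissible :: "'a set \<Rightarrow> ('a \<Rightarrow> 'a \<Rightarrow> real) \<Rightarrow> 'a topology \<Rightarrow> bool" where
  "Lorentzian_admissible X d T \<longleftrightarrow>
     topspace T = X \<and>
     continuous_map (prod_topology T T) euclideanreal (\<lambda>(x, y). d x y) \<and>
     (\<forall>\<epsilon>>0. compactin (prod_topology T T) {(p, q). p \<in> X \<and> q \<in> X \<and> d p q \<ge> \<epsilon>})"

locale bounded_Lorentzian_metric_space =
  fixes X :: "'a set" and d :: "'a \<Rightarrow> 'a \<Rightarrow> real"
  assumes nonneg: "\<lbrakk>x \<in> X; y \<in> X\<rbrakk> \<Longrightarrow> d x y \<ge> 0"
    and reverse_triangle:
      "\<lbrakk>x \<in> X; y \<in> X; z \<in> X; d x y > 0; d y z > 0\<rbrakk> \<Longrightarrow> d x z \<ge> d x y + d y z"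
    and ex_admissible: "\<exists>T. Lorentzian_admissible X d T"
    and distinguishing:
      "\<lbrakk>x \<in> X; y \<in> X; x \<noteq> y\<rbrakk> \<Longrightarrow> \<exists>z\<in>X. d x z \<noteq> d y z \<or> d z x \<noteq> d z y"

text \<open>The intersection of all admissible topologies; see \<open>openin_Lorentzian_topology\<close>.\<close>

definition Lorentzian_topology :: "'a set \<Rightarrow> ('a \<Rightarrow> 'a \<Rightarrow> real) \<Rightarrow> 'a topology" where
  "Lorentzian_topology X d = topology (\<lambda>U. \<forall>T. Lorentzian_admissible X d T \<longrightarrow> openin T U)"

lemma openin_Lorentzian_topology:
  "openin (Lorentzian_topology X d) U \<longleftrightarrow> (\<forall>T. Lorentzian_admissible X d T \<longrightarrow> openin T U)"
proof -
  have "istopology (\<lambda>U. \<forall>T. Lorentzian_admissible X d T \<longrightarrow> openin T U)"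
    unfolding istopology_def by (auto intro: openin_Int openin_Union)
  then show ?thesis
    by (simp add: Lorentzian_topology_def)
qed

lemma (in bounded_Lorentzian_metric_space) topspace_Lorentzian_topology:
  "topspace (Lorentzian_topology X d) = X"
proof (rule antisym)
  obtain T where T: "Lorentzian_admissible X d T"
    using ex_admissible by (rule exE)
  have "\<forall>T'. Lorentzian_admissible X d T' \<longrightarrow> openin T' (topspace (Lorentzian_topology X d))"
    using openin_Lorentzian_topology[of X d "topspace (Lorentzian_topology X d)"]
    by (simp only: openin_topspace)
  with T have "openin T (topspace (Lorentzian_topology X d))"
    by simp
  then have "topspace (Lorentzian_topology X d) \<subseteq> topspace T"
    by (rule openin_subset)
  with T show "topspace (Lorentzian_topology X d) \<subseteq> X"
    by (simp only: Lorentzian_admissible_def)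
  have "openin T' X" if "Lorentzian_admissible X d T'" for T'
    using that openin_topspace[of T'] by (simp only: Lorentzian_admissible_def)
  then have "openin (Lorentzian_topology X d) X"
    by (auto simp only: openin_Lorentzian_topology)
  then show "X \<subseteq> topspace (Lorentzian_topology X d)"
    by (rule openin_subset)
qed

definition includes_i0 :: "'a set \<Rightarrow> ('a \<Rightarrow> 'a \<Rightarrow> real) \<Rightarrow> bool" where
  "includes_i0 X d \<longleftrightarrow> (\<exists>i\<in>X. \<forall>p\<in>X. d i p = 0 \<and> d p i = 0)"

definition causal_le :: "'a set \<Rightarrow> ('a \<Rightarrow> 'a \<Rightarrow> real) \<Rightarrow> 'a \<Rightarrow> 'a \<Rightarrow> bool" where
  "causal_le X d x y \<longleftrightarrow> (\<forall>p\<in>X. d p y \<ge> d p x \<and> d x p \<ge> d y p)"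

definition causal_less :: "'a set \<Rightarrow> ('a \<Rightarrow> 'a \<Rightarrow> real) \<Rightarrow> 'a \<Rightarrow> 'a \<Rightarrow> bool" where
  "causal_less X d x y \<longleftrightarrow> causal_le X d x y \<and> x \<noteq> y"

definition is_time_function :: "'a set \<Rightarrow> ('a \<Rightarrow> 'a \<Rightarrow> real) \<Rightarrow> ('a \<Rightarrow> real) \<Rightarrow> bool" where
  "is_time_function X d \<tau> \<longleftrightarrow>
     continuous_map (Lorentzian_topology X d) euclideanreal \<tau> \<and>
     (\<forall>x\<in>X. \<forall>y\<in>X. causal_less X d x y \<longrightarrow> \<tau> x < \<tau> y)"

text \<open>A curve \<open>[a,b] \<rightarrow> X\<close> is a total function of which only the values on \<open>{a..b}\<close> matter. That it
  takes values in \<open>X\<close> is part of \<^const>\<open>continuous_map\<close>, by \<open>topspace_Lorentzian_topology\<close>.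
  One-point domains are allowed.\<close>

definition isocausal_curve ::
  "'a set \<Rightarrow> ('a \<Rightarrow> 'a \<Rightarrow> real) \<Rightarrow> real \<Rightarrow> real \<Rightarrow> (real \<Rightarrow> 'a) \<Rightarrow> bool" where
  "isocausal_curve X d a b \<sigma> \<longleftrightarrow>
     a \<le> b \<and>
     continuous_map (top_of_set {a..b}) (Lorentzian_topology X d) \<sigma> \<and>
     (\<forall>t\<in>{a..b}. \<forall>t'\<in>{a..b}. t < t' \<longrightarrow> causal_less X d (\<sigma> t) (\<sigma> t'))"

definition maximizing_curve ::
  "('a \<Rightarrow> 'a \<Rightarrow> real) \<Rightarrow> real \<Rightarrow> real \<Rightarrow> (real \<Rightarrow> 'a) \<Rightarrow> bool" where
  "maximizing_curve d a b \<sigma> \<longleftrightarrow>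
     (\<forall>t\<in>{a..b}. \<forall>t'\<in>{a..b}. \<forall>t''\<in>{a..b}. t < t' \<and> t' < t'' \<longrightarrow>
        d (\<sigma> t) (\<sigma> t') + d (\<sigma> t') (\<sigma> t'') = d (\<sigma> t) (\<sigma> t''))"

definition constant_extension :: "real \<Rightarrow> real \<Rightarrow> (real \<Rightarrow> 'a) \<Rightarrow> real \<Rightarrow> 'a" where
  "constant_extension a b \<sigma> s = (if s < a then \<sigma> a else if s > b then \<sigma> b else \<sigma> s)"

text \<open>Uniform convergence refers to some metric inducing the topology. Where this notion is used the
  space is compact, so every such metric gives the same notion.\<close>

definition curves_converge_uniformly ::
  "'a set \<Rightarrow> ('a \<Rightarrow> 'a \<Rightarrow> real) \<Rightarrow> (nat \<Rightarrow> real) \<Rightarrow> (nat \<Rightarrow> real) \<Rightarrow> (nat \<Rightarrow> real \<Rightarrow> 'a) \<Rightarrow>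
    real \<Rightarrow> real \<Rightarrow> (real \<Rightarrow> 'a) \<Rightarrow> bool" where
  "curves_converge_uniformly X d a\<^sub>n b\<^sub>n \<sigma>\<^sub>n a b \<sigma> \<longleftrightarrow>
     a\<^sub>n \<longlonglongrightarrow> a \<and> b\<^sub>n \<longlonglongrightarrow> b \<and>
     (\<exists>\<rho>. Metric_space X \<rho> \<and> Metric_space.mtopology X \<rho> = Lorentzian_topology X d \<and>
        (\<forall>\<epsilon>>0. \<forall>\<^sub>F n in sequentially. \<forall>s.
           \<rho> (constant_extension (a\<^sub>n n) (b\<^sub>n n) (\<sigma>\<^sub>n n) s) (constant_extension a b \<sigma> s) < \<epsilon>))"

definition sequence_accumulation_point :: "(nat \<Rightarrow> real) \<Rightarrow> real \<Rightarrow> bool" where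
  "sequence_accumulation_point x l \<longleftrightarrow> (\<exists>r::nat \<Rightarrow> nat. strict_mono r \<and> (x \<circ> r) \<longlonglongrightarrow> l)"

end

theory Submission
  imports Defs "HOL-Library.Diagonal_Subsequence"
begin

text \<open>
  The proof is an Arzela-Ascoli argument in which equicontinuity comes from the time function.

  The topology of the space is that of the distinction metric, which compares two points by
  the supremum over all third points of the differences of their Lorentzian distances
  (\<open>Lorentzian_topology_eq_distinction\<close>). The tube lemma shows that this metric topology is
  coarser than every admissible one. If the space contains the point at spacelike infinity, then
  the metric topology is compact, hence admissible itself, hence the coarsest admissible topology.

  On a compact space the closed causal relation and a time function \<^term>\<open>\<tau>\<close> control the
  metric: causally related points at nearly the same time are near each other, uniformly
  (\<open>distinction_small_if_time_gap_small\<close>). Two points of a curve parametrized by \<^term>\<open>\<tau>\<close>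
  are causally related and their times are their parameters, so all such curves share one modulus
  of continuity, and so do their constant extensions. The parameters range over the bounded set of
  values of \<^term>\<open>\<tau>\<close>, so the endpoints converge along a subsequence, and by
  \<open>Arzela_Ascoli_compact_target\<close> the extended curves converge uniformly along a further one.

  The limit curve is again parametrized by \<^term>\<open>\<tau>\<close>, by continuity of \<^term>\<open>\<tau>\<close>;
  in particular it is injective. It is causally monotone because the causal relation is closed.
  Together this makes it isocausal. The equations for maximizing curves pass to the limit by
  continuity of the Lorentzian distance.
\<close>

section \<open>Arzela-Ascoli for a compact metric target\<close>

text \<open>A diagonal argument: one subsequence serves all points of a countable set. Applied to a
  two-point set it extracts a common subsequence for two sequences.\<close>

lemma (in Metric_space) pointwise_convergent_subsequence:
  fixes f :: "nat \<Rightarrow> 'b \<Rightarrow> 'a"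
  assumes "compact_space mtopology" "countable S" and fM: "\<And>n s. s \<in> S \<Longrightarrow> f n s \<in> M"
  obtains r :: "nat \<Rightarrow> nat" where "strict_mono r"
    "\<And>s. s \<in> S \<Longrightarrow> \<exists>l. limitin mtopology (\<lambda>n. f (r n) s) l sequentially"
proof (cases "S = {}")
  case True
  then show ?thesis
    using that[of id] by (simp add: strict_mono_id)
next
  case False
  define e where "e = from_nat_into S"
  have eS: "e k \<in> S" for k
    using False by (simp add: e_def from_nat_into)
  define P where "P k r \<longleftrightarrow> (\<exists>l. limitin mtopology (\<lambda>n. f (r n) (e k)) l sequentially)"
    for k and r :: "nat \<Rightarrow> nat"
  interpret subseqs P
  proof
    fix k and r :: "nat \<Rightarrow> nat"
    have "range (\<lambda>n. f (r n) (e k)) \<subseteq> M"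
      using fM eS by auto
    then obtain l q where "strict_mono q"
      "limitin mtopology ((\<lambda>n. f (r n) (e k)) \<circ> q) l sequentially"
      using assms(1) unfolding compact_space_sequentially by blast
    then show "\<exists>q. strict_mono q \<and> P k (r \<circ> q)"
      by (auto simp: P_def o_def)
  qed
  have stable: "P k (r \<circ> q)" if "strict_mono q" "P k r" for k q and r :: "nat \<Rightarrow> nat"
    using that limitin_subsequence[of q] by (fastforce simp: P_def o_def)
  have "\<exists>l. limitin mtopology (\<lambda>n. f (diagseq n) s) l sequentially" if "s \<in> S" for s
  proof -
    obtain k where k: "s = e k"
      using \<open>s \<in> S\<close> \<open>countable S\<close> by (metis e_def from_nat_into_surj)
    have "P k (diagseq \<circ> (+) (Suc k))"
      using stable by (rule diagseq_holds)
    then obtain l where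
      "limitin mtopology (\<lambda>n. f (diagseq (n + Suc k)) s) l sequentially"
      by (auto simp: P_def k o_def add.commute)
    then have "limitin mtopology (\<lambda>n. f (diagseq n) s) l sequentially"
      by (rule limitin_sequentially_offset_rev)
    then show ?thesis
      by blast
  qed
  with subseq_diagseq show ?thesis
    by (rule that)
qed

text \<open>The Arzela-Ascoli theorem for maps into a metric space given by a carrier. The maps
  converge along a subsequence on a countable dense subset of the domain. Equicontinuity and a
  finite net taken from this subset make the subsequence uniformly Cauchy, and a compact target is
  complete.\<close>

lemma (in Metric_space) Arzela_Ascoli_compact_target:
  fixes f :: "nat \<Rightarrow> 'b::{metric_space, second_countable_topology} \<Rightarrow> 'a"
  assumes compact: "compact_space mtopology" and "compact K"
    and fM: "\<And>n s. s \<in> K \<Longrightarrow> f n s \<in> M"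
    and equicont: "\<And>\<epsilon>. \<epsilon> > 0 \<Longrightarrow>
      \<exists>\<delta>>0. \<forall>n. \<forall>s\<in>K. \<forall>t\<in>K. dist s t < \<delta> \<longrightarrow> d (f n s) (f n t) < \<epsilon>"
  obtains r :: "nat \<Rightarrow> nat" and g where "strict_mono r" "\<And>s. s \<in> K \<Longrightarrow> g s \<in> M"
    "\<And>\<epsilon>. \<epsilon> > 0 \<Longrightarrow> \<forall>\<^sub>F n in sequentially. \<forall>s\<in>K. d (f (r n) s) (g s) < \<epsilon>"
proof -
  obtain T where T: "countable T" "T \<subseteq> K" "K \<subseteq> closure T"
    by (rule separable)
  obtain r :: "nat \<Rightarrow> nat" where r: "strict_mono r"
    and lim: "\<And>s. s \<in> T \<Longrightarrow> \<exists>l. limitin mtopology (\<lambda>n. f (r n) s) l sequentially"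
    using pointwise_convergent_subsequence[of T f] compact T fM by (metis subsetD)
  have Cauchy: "\<exists>N. \<forall>m\<ge>N. \<forall>n\<ge>N. \<forall>s\<in>K. d (f (r m) s) (f (r n) s) < \<epsilon>" if "\<epsilon> > 0" for \<epsilon>
  proof -
    obtain \<delta> where "\<delta> > 0" and \<delta>:
      "\<And>n s t. \<lbrakk>s \<in> K; t \<in> K; dist s t < \<delta>\<rbrakk> \<Longrightarrow> d (f n s) (f n t) < \<epsilon> / 3"
      using equicont[of "\<epsilon> / 3"] \<open>\<epsilon> > 0\<close> by auto
    have "K \<subseteq> (\<Union>c\<in>T. ball c \<delta>)"
      using T(3) \<open>\<delta> > 0\<close> by (fastforce simp: closure_approachable)
    then obtain C where C: "C \<subseteq> T" "finite C" "K \<subseteq> (\<Union>c\<in>C. ball c \<delta>)"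
      using compactE_image[OF \<open>compact K\<close>, of T "\<lambda>c. ball c \<delta>"] by auto
    have "\<exists>N. \<forall>m\<ge>N. \<forall>n\<ge>N. d (f (r m) c) (f (r n) c) < \<epsilon> / 3" if "c \<in> C" for c
    proof -
      have "c \<in> T" "c \<in> K"
        using that C(1) T(2) by auto
      then have "MCauchy (\<lambda>n. f (r n) c)"
        using lim fM by (blast intro: convergent_imp_MCauchy)
      then show ?thesis
        using \<open>\<epsilon> > 0\<close> unfolding MCauchy_def
        by (metis zero_less_divide_iff zero_less_numeral)
    qed
    then obtain N where N:
      "\<And>c m n. \<lbrakk>c \<in> C; m \<ge> N c; n \<ge> N c\<rbrakk> \<Longrightarrow> d (f (r m) c) (f (r n) c) < \<epsilon> / 3"
      by metis
    show ?thesis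
    proof (intro exI allI impI ballI)
      fix m n s assume m: "Max (N ` C) \<le> m" and n: "Max (N ` C) \<le> n" and s: "s \<in> K"
      obtain c where c: "c \<in> C" "dist s c < \<delta>"
        using C(3) s by (force simp: dist_commute)
      then have cK: "c \<in> K" and "N c \<le> Max (N ` C)"
        using C T by auto
      then have "d (f (r m) c) (f (r n) c) < \<epsilon> / 3"
        using N c m n by auto
      moreover have "d (f (r m) s) (f (r m) c) < \<epsilon> / 3" "d (f (r n) s) (f (r n) c) < \<epsilon> / 3"
        using \<delta> s cK c by auto
      ultimately show "d (f (r m) s) (f (r n) s) < \<epsilon>"
        using triangle[of "f (r m) s" "f (r m) c" "f (r n) s"]
          triangle'[of "f (r m) c" "f (r n) c" "f (r n) s"] fM s cK by auto
    qed
  qed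
  have "\<exists>l. limitin mtopology (\<lambda>n. f (r n) s) l sequentially" if s: "s \<in> K" for s
  proof -
    have "MCauchy (\<lambda>n. f (r n) s)"
      unfolding MCauchy_def
    proof (intro conjI allI impI)
      show "range (\<lambda>n. f (r n) s) \<subseteq> M"
        using fM s by auto
    next
      fix \<epsilon> :: real assume "\<epsilon> > 0"
      then show "\<exists>N. \<forall>n n'. N \<le> n \<longrightarrow> N \<le> n' \<longrightarrow> d (f (r n) s) (f (r n') s) < \<epsilon>"
        using Cauchy s by meson
    qed
    then show ?thesis
      using compact_space_imp_mcomplete[OF compact] by (auto simp: mcomplete_def)
  qed
  then obtain g where g: "\<And>s. s \<in> K \<Longrightarrow> limitin mtopology (\<lambda>n. f (r n) s) (g s) sequentially"
    by metis
  show ?thesis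
  proof (rule that[OF r])
    show gM: "g s \<in> M" if "s \<in> K" for s
      using g[OF that] by (rule limitin_mspace)
    show "\<forall>\<^sub>F n in sequentially. \<forall>s\<in>K. d (f (r n) s) (g s) < \<epsilon>" if "\<epsilon> > 0" for \<epsilon>
    proof -
      obtain N where N: "\<And>m n s. \<lbrakk>m \<ge> N; n \<ge> N; s \<in> K\<rbrakk> \<Longrightarrow> d (f (r m) s) (f (r n) s) < \<epsilon> / 2"
        using Cauchy[of "\<epsilon> / 2"] \<open>\<epsilon> > 0\<close> by auto
      have "d (f (r n) s) (g s) < \<epsilon>" if n: "n \<ge> N" and s: "s \<in> K" for n s
      proof -
        obtain N' where N': "\<And>m. m \<ge> N' \<Longrightarrow> d (f (r m) s) (g s) < \<epsilon> / 2"
          using g[OF s] \<open>\<epsilon> > 0\<close> unfolding limit_metric_sequentially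
          by (metis half_gt_zero)
        let ?m = "max N N'"
        have "d (f (r n) s) (g s) \<le> d (f (r n) s) (f (r ?m) s) + d (f (r ?m) s) (g s)"
          using fM gM s by (intro triangle) auto
        also have "\<dots> < \<epsilon>"
          using N[of n ?m s] N'[of ?m] n s by auto
        finally show ?thesis .
      qed
      then show ?thesis
        by (auto simp: eventually_sequentially)
    qed
  qed
qed

section \<open>The distinction metric and the Lorentzian topology\<close>

text \<open>Although the space need not be compact for \<^term>\<open>T\<close>, the estimate is uniform in
  \<^term>\<open>z\<close>. On the compact projection of the superlevel set of \<^term>\<open>h\<close> the tube lemma
  gives it; at any other \<^term>\<open>z\<close> both values of \<^term>\<open>h\<close> lie between \<open>0\<close> and
  \<^term>\<open>\<epsilon>\<close>.\<close>

lemma uniformly_close_neighbourhood: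
  fixes h :: "'a \<Rightarrow> 'a \<Rightarrow> real"
  assumes cont: "continuous_map (prod_topology T T) euclideanreal (\<lambda>(x, y). h x y)"
    and compact: "compactin (prod_topology T T)
      {(p, q). p \<in> topspace T \<and> q \<in> topspace T \<and> h p q \<ge> \<epsilon>}"
    and nonneg: "\<And>p q. \<lbrakk>p \<in> topspace T; q \<in> topspace T\<rbrakk> \<Longrightarrow> h p q \<ge> 0"
    and "\<epsilon> > 0" "x \<in> topspace T"
  obtains U where "openin T U" "x \<in> U"
    "\<And>y z. \<lbrakk>y \<in> U; z \<in> topspace T\<rbrakk> \<Longrightarrow> \<bar>h x z - h y z\<bar> < \<epsilon>"
proof -
  define C where "C = snd ` {(p, q). p \<in> topspace T \<and> q \<in> topspace T \<and> h p q \<ge> \<epsilon>}"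
  have C: "compactin T C"
    unfolding C_def using compact continuous_map_snd by (rule image_compactin)
  define W where "W =
    {p \<in> topspace (prod_topology T T). \<bar>h x (snd p) - h (fst p) (snd p)\<bar> \<in> {..<\<epsilon>}}"
  have contx: "continuous_map (prod_topology T T) euclideanreal (\<lambda>p. h x (snd p))"
  proof -
    have "continuous_map (prod_topology T T) (prod_topology T T) (\<lambda>p. (x, snd p))"
      using \<open>x \<in> topspace T\<close> by (intro continuous_intros) auto
    from continuous_map_compose[OF this cont] show ?thesis
      by (simp add: o_def)
  qed
  have "continuous_map (prod_topology T T) euclideanreal
      (\<lambda>p. \<bar>h x (snd p) - h (fst p) (snd p)\<bar>)"
    using cont contx by (intro continuous_intros) (auto simp: case_prod_unfold)
  then have W: "openin (prod_topology T T) W"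
    unfolding W_def by (rule openin_continuous_map_preimage) auto
  have "{x} \<times> C \<subseteq> W"
    using \<open>\<epsilon> > 0\<close> \<open>x \<in> topspace T\<close> compactin_subset_topspace[OF C] by (auto simp: W_def)
  from tube_lemma_right[OF W C \<open>x \<in> topspace T\<close> this]
  obtain U V where UV: "openin T U" "x \<in> U" "C \<subseteq> V" "U \<times> V \<subseteq> W"
    by blast
  show ?thesis
  proof (rule that[OF UV(1,2)])
    fix y z assume y: "y \<in> U" and z: "z \<in> topspace T"
    have yT: "y \<in> topspace T"
      using UV(1) y openin_subset by blast
    show "\<bar>h x z - h y z\<bar> < \<epsilon>"
    proof (cases "z \<in> C")
      case True
      then have "(y, z) \<in> W"
        using UV(3,4) y by blast
      then show ?thesis
        by (simp add: W_def)
    next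
      case False
      then have "h p z < \<epsilon>" if "p \<in> topspace T" for p
        using that z unfolding C_def by force
      from this[OF yT] this[OF \<open>x \<in> topspace T\<close>] show ?thesis
        using nonneg[OF yT z] nonneg[OF \<open>x \<in> topspace T\<close> z] by auto
    qed
  qed
qed

context bounded_Lorentzian_metric_space
begin

lemma d_bounded:
  obtains B where "\<And>x y. \<lbrakk>x \<in> X; y \<in> X\<rbrakk> \<Longrightarrow> d x y \<le> B"
proof -
  obtain T where T: "continuous_map (prod_topology T T) euclideanreal (\<lambda>(x, y). d x y)"
    "compactin (prod_topology T T) {(p, q). p \<in> X \<and> q \<in> X \<and> d p q \<ge> 1}"
    using ex_admissible by (auto simp: Lorentzian_admissible_def)
  have "compact ((\<lambda>(x, y). d x y) ` {(p, q). p \<in> X \<and> q \<in> X \<and> d p q \<ge> 1})"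
    using image_compactin[OF T(2,1)] by simp
  then have "bdd_above ((\<lambda>(x, y). d x y) ` {(p, q). p \<in> X \<and> q \<in> X \<and> d p q \<ge> 1})"
    by (intro bounded_imp_bdd_above compact_imp_bounded)
  then obtain B where "\<And>x y. \<lbrakk>x \<in> X; y \<in> X; d x y \<ge> 1\<rbrakk> \<Longrightarrow> d x y \<le> B"
    by (fastforce simp: bdd_above_def)
  then have "d x y \<le> max B 1" if "x \<in> X" "y \<in> X" for x y
    using that by (cases "d x y \<ge> 1") (auto simp: le_max_iff_disj)
  with that show ?thesis
    by blast
qed

text \<open>The value \<open>0\<close> off the space is there because \<^locale>\<open>Metric_space\<close> asks for
  nonnegativity and symmetry of a metric at all arguments, whether or not in the carrier.\<close>

definition distinction_metric :: "'a \<Rightarrow> 'a \<Rightarrow> real" where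
  "distinction_metric x y =
    (if x \<in> X \<and> y \<in> X then SUP z\<in>X. max \<bar>d x z - d y z\<bar> \<bar>d z x - d z y\<bar> else 0)"

lemma distinction_metric_ge:
  assumes "x \<in> X" "y \<in> X" "z \<in> X"
  shows "\<bar>d x z - d y z\<bar> \<le> distinction_metric x y" "\<bar>d z x - d z y\<bar> \<le> distinction_metric x y"
proof -
  obtain B where B: "\<And>x y. \<lbrakk>x \<in> X; y \<in> X\<rbrakk> \<Longrightarrow> d x y \<le> B"
    using d_bounded by blast
  have "max \<bar>d x w - d y w\<bar> \<bar>d w x - d w y\<bar> \<le> B" if "w \<in> X" for w
    using that assms B[of x w] B[of y w] B[of w x] B[of w y]
      nonneg[of x w] nonneg[of y w] nonneg[of w x] nonneg[of w y] by auto
  then have "bdd_above ((\<lambda>z. max \<bar>d x z - d y z\<bar> \<bar>d z x - d z y\<bar>) ` X)"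
    by (auto simp: bdd_above_def)
  then have "max \<bar>d x z - d y z\<bar> \<bar>d z x - d z y\<bar> \<le> distinction_metric x y"
    using assms cSUP_upper[OF \<open>z \<in> X\<close>, of "\<lambda>z. max \<bar>d x z - d y z\<bar> \<bar>d z x - d z y\<bar>"]
    by (simp add: distinction_metric_def)
  then show "\<bar>d x z - d y z\<bar> \<le> distinction_metric x y" "\<bar>d z x - d z y\<bar> \<le> distinction_metric x y"
    by simp_all
qed

lemma distinction_metric_le:
  assumes "x \<in> X" "y \<in> X"
    and "\<And>z. z \<in> X \<Longrightarrow> \<bar>d x z - d y z\<bar> \<le> \<epsilon>" "\<And>z. z \<in> X \<Longrightarrow> \<bar>d z x - d z y\<bar> \<le> \<epsilon>"
  shows "distinction_metric x y \<le> \<epsilon>"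
proof -
  have "(SUP z\<in>X. max \<bar>d x z - d y z\<bar> \<bar>d z x - d z y\<bar>) \<le> \<epsilon>"
    using assms by (intro cSUP_least) auto
  with assms show ?thesis
    by (simp add: distinction_metric_def)
qed

sublocale distinction: Metric_space X distinction_metric
proof
  show "0 \<le> distinction_metric x y" for x y
  proof (cases "x \<in> X \<and> y \<in> X")
    case True
    then show ?thesis
      using distinction_metric_ge(1)[of x y x] by linarith
  next
    case False
    then show ?thesis
      by (auto simp: distinction_metric_def)
  qed
  show "distinction_metric x y = distinction_metric y x" for x y
    by (simp add: distinction_metric_def abs_minus_commute)
  show "distinction_metric x y = 0 \<longleftrightarrow> x = y" if "x \<in> X" "y \<in> X" for x y
  proof
    assume 0: "distinction_metric x y = 0"
    have "d x z = d y z" "d z x = d z y" if "z \<in> X" for z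
      using distinction_metric_ge[of x y z] that \<open>x \<in> X\<close> \<open>y \<in> X\<close> 0 by auto
    with distinguishing[OF that] show "x = y"
      by auto
  next
    assume "x = y"
    with that show "distinction_metric x y = 0"
      by (auto simp: distinction_metric_def image_constant_conv)
  qed
  show "distinction_metric x z \<le> distinction_metric x y + distinction_metric y z"
    if xyz: "x \<in> X" "y \<in> X" "z \<in> X" for x y z
  proof (rule distinction_metric_le[OF xyz(1,3)])
    fix w assume w: "w \<in> X"
    show "\<bar>d x w - d z w\<bar> \<le> distinction_metric x y + distinction_metric y z"
      using distinction_metric_ge(1)[OF xyz(1,2) w] distinction_metric_ge(1)[OF xyz(2,3) w]
      by linarith
    show "\<bar>d w x - d w z\<bar> \<le> distinction_metric x y + distinction_metric y z"
      using distinction_metric_ge(2)[OF xyz(1,2) w] distinction_metric_ge(2)[OF xyz(2,3) w]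
      by linarith
  qed
qed

text \<open>Every admissible topology is finer than the metric one: each of the two halves of the
  supremum is small on a neighbourhood, for \<^term>\<open>d\<close> and for \<^term>\<open>d\<close> with its
  arguments exchanged.\<close>

lemma continuous_map_admissible_distinction:
  assumes T: "Lorentzian_admissible X d T"
  shows "continuous_map T distinction.mtopology id"
proof -
  from T have top: "topspace T = X"
    and cont: "continuous_map (prod_topology T T) euclideanreal (\<lambda>(x, y). d x y)"
    and compact: "\<And>\<epsilon>. \<epsilon> > 0 \<Longrightarrow>
      compactin (prod_topology T T) {(p, q). p \<in> topspace T \<and> q \<in> topspace T \<and> d p q \<ge> \<epsilon>}"
    by (auto simp: Lorentzian_admissible_def)
  have swap: "continuous_map (prod_topology T T) (prod_topology T T) (\<lambda>(x, y). (y, x))"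
    by (simp add: case_prod_unfold continuous_map_pairedI continuous_map_fst continuous_map_snd)
  have cont': "continuous_map (prod_topology T T) euclideanreal (\<lambda>(x, y). d y x)"
    using continuous_map_compose[OF swap cont] by (simp add: o_def case_prod_unfold)
  have compact': "compactin (prod_topology T T)
      {(p, q). p \<in> topspace T \<and> q \<in> topspace T \<and> d q p \<ge> \<epsilon>}" if "\<epsilon> > 0" for \<epsilon>
  proof -
    have "(\<lambda>(x, y). (y, x)) ` {(p, q). p \<in> topspace T \<and> q \<in> topspace T \<and> d p q \<ge> \<epsilon>} =
        {(p, q). p \<in> topspace T \<and> q \<in> topspace T \<and> d q p \<ge> \<epsilon>}"
      by force
    with image_compactin[OF compact[OF that] swap] show ?thesis
      by simp
  qed
  have "\<exists>U. openin T U \<and> x \<in> U \<and> (\<forall>y\<in>U. id y \<in> distinction.mball (id x) \<epsilon>)"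
    if x: "x \<in> topspace T" and "\<epsilon> > 0" for x \<epsilon>
  proof -
    have e: "\<epsilon> / 2 > 0"
      using \<open>\<epsilon> > 0\<close> by simp
    obtain U where U: "openin T U" "x \<in> U"
      "\<And>y z. \<lbrakk>y \<in> U; z \<in> topspace T\<rbrakk> \<Longrightarrow> \<bar>d x z - d y z\<bar> < \<epsilon> / 2"
      using uniformly_close_neighbourhood[OF cont compact[OF e] _ e x] nonneg top by auto
    obtain V where V: "openin T V" "x \<in> V"
      "\<And>y z. \<lbrakk>y \<in> V; z \<in> topspace T\<rbrakk> \<Longrightarrow> \<bar>d z x - d z y\<bar> < \<epsilon> / 2"
      using uniformly_close_neighbourhood[OF cont' compact'[OF e] _ e x] nonneg top by auto
    have "id y \<in> distinction.mball (id x) \<epsilon>" if "y \<in> U \<inter> V" for y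
    proof -
      have "y \<in> X" "x \<in> X"
        using that x openin_subset[OF U(1)] top by auto
      moreover have "distinction_metric x y \<le> \<epsilon> / 2"
        using U(3)[of y] V(3)[of y] that \<open>y \<in> X\<close> \<open>x \<in> X\<close> top
        by (intro distinction_metric_le less_imp_le) auto
      ultimately show ?thesis
        using \<open>\<epsilon> > 0\<close> by auto
    qed
    with U V show ?thesis
      by (intro exI[of _ "U \<inter> V"]) auto
  qed
  then show ?thesis
    unfolding distinction.continuous_map_to_metric by blast
qed

text \<open>A ball around the point at spacelike infinity absorbs all points whose distances to and
  from every other point are small. What remains lies in the two projections of a superlevel set of
  \<^term>\<open>d\<close>, which are compact for an admissible topology and hence for the coarser metric
  one.\<close>

lemma compact_space_distinction:
  assumes "includes_i0 X d"
  shows "compact_space distinction.mtopology"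
proof -
  obtain i where i: "i \<in> X" and i0: "\<And>p. p \<in> X \<Longrightarrow> d i p = 0 \<and> d p i = 0"
    using assms by (auto simp: includes_i0_def)
  obtain T where T: "Lorentzian_admissible X d T"
    using ex_admissible by blast
  have "\<exists>\<F>. finite \<F> \<and> \<F> \<subseteq> \<U> \<and> X \<subseteq> \<Union>\<F>"
    if \<U>: "\<And>U. U \<in> \<U> \<Longrightarrow> openin distinction.mtopology U" "X \<subseteq> \<Union>\<U>" for \<U>
  proof -
    obtain U where "U \<in> \<U>" "i \<in> U"
      using \<U>(2) i by blast
    then obtain \<epsilon> where "\<epsilon> > 0" and ball: "distinction.mball i \<epsilon> \<subseteq> U"
      using \<U>(1) distinction.openin_mtopology by blast
    define K where "K = {(p, q). p \<in> X \<and> q \<in> X \<and> d p q \<ge> \<epsilon> / 2}"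
    have K: "compactin (prod_topology T T) K"
      using T half_gt_zero[OF \<open>\<epsilon> > 0\<close>] unfolding Lorentzian_admissible_def K_def by blast
    have "compactin T (fst ` K \<union> snd ` K)"
      using image_compactin[OF K continuous_map_fst] image_compactin[OF K continuous_map_snd]
      by (rule compactin_Un)
    then have "compactin distinction.mtopology (fst ` K \<union> snd ` K)"
      using image_compactin[OF _ continuous_map_admissible_distinction[OF T]] by fastforce
    moreover have "fst ` K \<union> snd ` K \<subseteq> \<Union>\<U>"
      using \<U>(2) by (auto simp: K_def)
    ultimately obtain \<F> where \<F>: "finite \<F>" "\<F> \<subseteq> \<U>" "fst ` K \<union> snd ` K \<subseteq> \<Union>\<F>"
      using \<U>(1) unfolding compactin_def by meson
    have "x \<in> \<Union>(insert U \<F>)" if x: "x \<in> X" for x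
    proof (cases "x \<in> fst ` K \<union> snd ` K")
      case True
      with \<F>(3) show ?thesis
        by auto
    next
      case False
      then have small: "d x z < \<epsilon> / 2 \<and> d z x < \<epsilon> / 2" if "z \<in> X" for z
        using that x by (force simp: K_def)
      have "distinction_metric i x \<le> \<epsilon> / 2"
      proof (rule distinction_metric_le[OF i x])
        fix z assume "z \<in> X"
        then show "\<bar>d i z - d x z\<bar> \<le> \<epsilon> / 2" "\<bar>d z i - d z x\<bar> \<le> \<epsilon> / 2"
          using small[of z] i0[of z] nonneg[of x z] nonneg[of z x] x by auto
      qed
      then show ?thesis
        using ball i x \<open>\<epsilon> > 0\<close> by force
    qed
    then have "X \<subseteq> \<Union>(insert U \<F>)"
      by blast
    with \<F> \<open>U \<in> \<U>\<close> show ?thesis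
      by (intro exI[of _ "insert U \<F>"]) simp
  qed
  then show ?thesis
    unfolding compact_space_def compactin_def by (auto simp: Ball_def)
qed

lemma continuous_map_d_distinction:
  "continuous_map (prod_topology distinction.mtopology distinction.mtopology) euclideanreal
    (\<lambda>(x, y). d x y)"
proof -
  have "\<exists>U. openin (prod_topology distinction.mtopology distinction.mtopology) U \<and> p \<in> U \<and>
      (\<forall>q\<in>U. (\<lambda>(x, y). d x y) q \<in> Met_TC.mball ((\<lambda>(x, y). d x y) p) \<epsilon>)"
    if "p \<in> X \<times> X" "\<epsilon> > 0" for p \<epsilon>
  proof -
    obtain x y where p: "p = (x, y)" "x \<in> X" "y \<in> X"
      using \<open>p \<in> X \<times> X\<close> by auto
    have "\<bar>d x y - d x' y'\<bar> < \<epsilon>"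
      if "x' \<in> X" "y' \<in> X" "distinction_metric x x' < \<epsilon> / 2" "distinction_metric y y' < \<epsilon> / 2"
      for x' y'
      using distinction_metric_ge(1)[of x x' y] distinction_metric_ge(2)[of y y' x'] p that
      by linarith
    then show ?thesis
      using p \<open>\<epsilon> > 0\<close>
      by (intro exI[of _ "distinction.mball x (\<epsilon> / 2) \<times> distinction.mball y (\<epsilon> / 2)"])
        (auto simp: openin_prod_Times_iff dist_real_def)
  qed
  then show ?thesis
    using Met_TC.continuous_map_to_metric[of "prod_topology distinction.mtopology distinction.mtopology"
        "\<lambda>(x, y). d x y"] by simp
qed

text \<open>The metric topology is coarser than every admissible topology and, by compactness, is itself
  admissible: superlevel sets of a continuous function on a compact space are compact. So it is the
  intersection of all admissible topologies.\<close>

lemma Lorentzian_topology_eq_distinction: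
  assumes "includes_i0 X d"
  shows "Lorentzian_topology X d = distinction.mtopology"
proof -
  have "Lorentzian_admissible X d distinction.mtopology"
    unfolding Lorentzian_admissible_def
  proof (intro conjI allI impI)
    fix \<epsilon> :: real
    let ?P = "prod_topology distinction.mtopology distinction.mtopology"
    have "closedin ?P {p \<in> topspace ?P. (\<lambda>(x, y). d x y) p \<in> {\<epsilon>..}}"
      using continuous_map_d_distinction by (rule closedin_continuous_map_preimage) simp
    moreover have "compact_space ?P"
      using compact_space_distinction[OF assms] by (simp add: compact_space_prod_topology)
    ultimately have "compactin ?P {p \<in> topspace ?P. (\<lambda>(x, y). d x y) p \<in> {\<epsilon>..}}"
      by (intro closedin_compact_space)
    also have "{p \<in> topspace ?P. (\<lambda>(x, y). d x y) p \<in> {\<epsilon>..}} =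
        {(p, q). p \<in> X \<and> q \<in> X \<and> d p q \<ge> \<epsilon>}"
      by auto
    finally show "compactin ?P {(p, q). p \<in> X \<and> q \<in> X \<and> d p q \<ge> \<epsilon>}" .
  qed (simp_all add: continuous_map_d_distinction)
  moreover have "openin T U"
    if T: "Lorentzian_admissible X d T" and U: "openin distinction.mtopology U" for T U
  proof -
    have "U \<subseteq> topspace T"
      using T openin_subset[OF U] by (simp add: Lorentzian_admissible_def)
    then have "{x \<in> topspace T. id x \<in> U} = U"
      by auto
    with openin_continuous_map_preimage[OF continuous_map_admissible_distinction[OF T] U]
    show ?thesis
      by simp
  qed
  ultimately show ?thesis
    by (auto simp: topology_eq openin_Lorentzian_topology)
qed

end

section \<open>Causal relation and time functions\<close>

context bounded_Lorentzian_metric_space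
begin

lemma tendsto_d_distinction:
  assumes "limitin distinction.mtopology x p F" "limitin distinction.mtopology y q F"
  shows "((\<lambda>n. d (x n) (y n)) \<longlongrightarrow> d p q) F"
proof -
  have "limitin (prod_topology distinction.mtopology distinction.mtopology)
      (\<lambda>n. (x n, y n)) (p, q) F"
    using assms by (simp add: limitin_pairwise o_def)
  from continuous_map_limit[OF continuous_map_d_distinction this] show ?thesis
    by (simp add: o_def)
qed

text \<open>The causal relation is closed, being defined by weak inequalities between values of the
  continuous function \<^term>\<open>d\<close>.\<close>

lemma causal_le_limit:
  assumes x: "limitin distinction.mtopology x p F" and y: "limitin distinction.mtopology y q F"
    and le: "\<forall>\<^sub>F n in F. causal_le X d (x n) (y n)" and "F \<noteq> bot"
  shows "causal_le X d p q"
  unfolding causal_le_def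
proof
  fix z assume z: "z \<in> X"
  then have c: "limitin distinction.mtopology (\<lambda>_. z) z F"
    by simp
  have "\<forall>\<^sub>F n in F. d z (x n) \<le> d z (y n)" "\<forall>\<^sub>F n in F. d (y n) z \<le> d (x n) z"
    using le z by (auto simp: causal_le_def elim!: eventually_mono)
  then show "d z p \<le> d z q \<and> d q z \<le> d p z"
    using tendsto_le[OF \<open>F \<noteq> bot\<close> tendsto_d_distinction[OF c y] tendsto_d_distinction[OF c x]]
      tendsto_le[OF \<open>F \<noteq> bot\<close> tendsto_d_distinction[OF x c] tendsto_d_distinction[OF y c]]
    by simp
qed

lemma tendsto_time_function:
  assumes "includes_i0 X d" "is_time_function X d \<tau>" "limitin distinction.mtopology x p F"
  shows "((\<lambda>n. \<tau> (x n)) \<longlongrightarrow> \<tau> p) F"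
proof -
  have "continuous_map distinction.mtopology euclideanreal \<tau>"
    using assms by (simp add: is_time_function_def Lorentzian_topology_eq_distinction)
  from continuous_map_limit[OF this assms(3)] show ?thesis
    by (simp add: o_def)
qed

lemma time_function_bounded:
  assumes "includes_i0 X d" "is_time_function X d \<tau>"
  obtains l u where "\<And>x. x \<in> X \<Longrightarrow> \<tau> x \<in> {l..u}"
proof -
  have "continuous_map distinction.mtopology euclideanreal \<tau>" "compactin distinction.mtopology X"
    using assms compact_space_distinction
    by (simp_all add: is_time_function_def Lorentzian_topology_eq_distinction compact_space_def)
  then have "bounded (\<tau> ` X)"
    using image_compactin by (fastforce intro: compact_imp_bounded)
  then obtain B where "\<And>x. x \<in> X \<Longrightarrow> \<bar>\<tau> x\<bar> \<le> B"
    by (auto simp: bounded_real)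
  then show ?thesis
    by (intro that[of "- B" B]) (simp add: abs_le_iff minus_le_iff)
qed

text \<open>The source of equicontinuity. If causally related pairs stayed apart while their time gaps
  tended to zero, a limit pair would be causally related, at a positive distance and without
  increase of \<^term>\<open>\<tau>\<close>, against the strict monotonicity of a time function.\<close>

lemma distinction_small_if_time_gap_small:
  assumes i0: "includes_i0 X d" and \<tau>: "is_time_function X d \<tau>" and "\<epsilon> > 0"
  obtains \<delta> where "\<delta> > 0"
    "\<And>x y. \<lbrakk>x \<in> X; y \<in> X; causal_le X d x y \<or> causal_le X d y x; \<bar>\<tau> x - \<tau> y\<bar> < \<delta>\<rbrakk>
      \<Longrightarrow> distinction_metric x y < \<epsilon>"
proof -
  have "\<exists>\<delta>>0. \<forall>x\<in>X. \<forall>y\<in>X. causal_le X d x y \<longrightarrow> \<tau> y - \<tau> x < \<delta> \<longrightarrow> distinction_metric x y < \<epsilon>"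
  proof (rule ccontr)
    assume neg: "\<not> ?thesis"
    have "\<exists>x y. x \<in> X \<and> y \<in> X \<and> causal_le X d x y \<and> \<tau> y - \<tau> x < inverse (real (Suc n)) \<and>
        \<epsilon> \<le> distinction_metric x y" for n
    proof (rule ccontr)
      assume none: "\<not> ?thesis"
      have "inverse (real (Suc n)) > 0"
        by simp
      moreover have "\<forall>x\<in>X. \<forall>y\<in>X. causal_le X d x y \<longrightarrow> \<tau> y - \<tau> x < inverse (real (Suc n)) \<longrightarrow>
          distinction_metric x y < \<epsilon>"
        using none by (meson not_le)
      ultimately show False
        using neg by blast
    qed
    then obtain x y where xy: "\<And>n. x n \<in> X" "\<And>n. y n \<in> X" "\<And>n. causal_le X d (x n) (y n)"
      "\<And>n. \<tau> (y n) - \<tau> (x n) < inverse (real (Suc n))" "\<And>n. \<epsilon> \<le> distinction_metric (x n) (y n)"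
      by metis
    have XX: "(if s then x n else y n) \<in> X" for n and s :: bool
      using xy by simp
    obtain r :: "nat \<Rightarrow> nat" where r: "strict_mono r" and lim: "\<And>s::bool. s \<in> UNIV \<Longrightarrow>
        \<exists>l. limitin distinction.mtopology (\<lambda>n. if s then x (r n) else y (r n)) l sequentially"
      using distinction.pointwise_convergent_subsequence[OF compact_space_distinction[OF i0],
          of UNIV "\<lambda>n s. if s then x n else y n"] XX by auto
    obtain p q where p: "limitin distinction.mtopology (\<lambda>n. x (r n)) p sequentially"
      and q: "limitin distinction.mtopology (\<lambda>n. y (r n)) q sequentially"
      using lim[of True] lim[of False] by auto
    have "causal_le X d p q"
      using causal_le_limit[OF p q] xy(3) by simp
    moreover have "\<tau> q \<le> \<tau> p"
    proof -
      have "(\<lambda>n. \<tau> (y (r n)) - \<tau> (x (r n))) \<longlonglongrightarrow> \<tau> q - \<tau> p"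
        using tendsto_time_function[OF i0 \<tau>] p q by (intro tendsto_diff)
      moreover have "(\<lambda>n. inverse (real (Suc (r n)))) \<longlonglongrightarrow> 0"
        using LIMSEQ_subseq_LIMSEQ[OF LIMSEQ_inverse_real_of_nat r] by (simp add: o_def)
      ultimately have "\<tau> q - \<tau> p \<le> 0"
        using xy(4) by (intro LIMSEQ_le) (auto intro: less_imp_le)
      then show ?thesis
        by simp
    qed
    moreover have "p \<in> X" "q \<in> X"
      using p q distinction.limitin_mspace by auto
    ultimately have "p = q"
      using \<tau> unfolding is_time_function_def causal_less_def by (metis not_le)
    have "(\<lambda>n. distinction_metric (x (r n)) p) \<longlonglongrightarrow> 0"
      "(\<lambda>n. distinction_metric (y (r n)) p) \<longlonglongrightarrow> 0"
      using p q \<open>p = q\<close> by (simp_all add: distinction.limitin_metric_dist_null)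
    then have "\<forall>\<^sub>F n in sequentially. distinction_metric (x (r n)) p < \<epsilon> / 2"
      "\<forall>\<^sub>F n in sequentially. distinction_metric (y (r n)) p < \<epsilon> / 2"
      using half_gt_zero[OF \<open>\<epsilon> > 0\<close>] by (blast dest: order_tendstoD(2))+
    then have "\<forall>\<^sub>F n in sequentially. False"
    proof eventually_elim
      case (elim n)
      then show ?case
        using distinction.triangle'[OF xy(1) \<open>p \<in> X\<close> xy(2), of "r n" "r n"] xy(5)[of "r n"] by simp
    qed
    then show False
      by simp
  qed
  then obtain \<delta> where "\<delta> > 0" and \<delta>: "\<And>x y. \<lbrakk>x \<in> X; y \<in> X; causal_le X d x y; \<tau> y - \<tau> x < \<delta>\<rbrakk>
      \<Longrightarrow> distinction_metric x y < \<epsilon>"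
    by blast
  show ?thesis
  proof (rule that[OF \<open>\<delta> > 0\<close>])
    fix x y
    assume "x \<in> X" "y \<in> X" "causal_le X d x y \<or> causal_le X d y x" "\<bar>\<tau> x - \<tau> y\<bar> < \<delta>"
    then show "distinction_metric x y < \<epsilon>"
      using \<delta>[of x y] \<delta>[of y x] distinction.commute[of x y] by auto
  qed
qed

end

section \<open>The limit curve theorem\<close>

lemma constant_extension_eq_clamp:
  "a \<le> b \<Longrightarrow> constant_extension a b \<sigma> s = \<sigma> (max a (min b s))"
  by (auto simp: constant_extension_def max_def min_def)

lemma clamp_distance_le:
  fixes a b a' b' s t :: real
  shows "\<bar>max a (min b s) - max a (min b t)\<bar> \<le> \<bar>s - t\<bar>"
    and "\<bar>max a (min b s) - max a' (min b' s)\<bar> \<le> max \<bar>a - a'\<bar> \<bar>b - b'\<bar>"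
  by (auto simp: max_def min_def)

theorem theorem5p12:
  fixes X :: "'a set" and d :: "'a \<Rightarrow> 'a \<Rightarrow> real" and \<tau> :: "'a \<Rightarrow> real"
    and a b :: "nat \<Rightarrow> real" and \<sigma> :: "nat \<Rightarrow> real \<Rightarrow> 'a"
  assumes "bounded_Lorentzian_metric_space X d"
    and "includes_i0 X d"
    and "is_time_function X d \<tau>"
    and "\<And>n. isocausal_curve X d (a n) (b n) (\<sigma> n)"
    and "\<And>n t. t \<in> {a n..b n} \<Longrightarrow> \<tau> (\<sigma> n t) = t"
    and "\<nexists>l. sequence_accumulation_point a l \<and> sequence_accumulation_point b l"
  shows "\<exists>(\<alpha>::real) (\<beta>::real) (\<sigma>' :: real \<Rightarrow> 'a) (r :: nat \<Rightarrow> nat).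
           isocausal_curve X d \<alpha> \<beta> \<sigma>' \<and>
           strict_mono r \<and>
           curves_converge_uniformly X d (a \<circ> r) (b \<circ> r) (\<sigma> \<circ> r) \<alpha> \<beta> \<sigma>' \<and>
           ((\<forall>n. maximizing_curve d (a n) (b n) (\<sigma> n)) \<longrightarrow> maximizing_curve d \<alpha> \<beta> \<sigma>')"
proof -
  interpret bounded_Lorentzian_metric_space X d
    by fact
  note i0 = \<open>includes_i0 X d\<close> and \<tau> = \<open>is_time_function X d \<tau>\<close>
  have top: "Lorentzian_topology X d = distinction.mtopology"
    using i0 by (rule Lorentzian_topology_eq_distinction)
  have ab: "a n \<le> b n" for n
    using assms(4) by (auto simp: isocausal_curve_def)
  have \<sigma>X: "\<sigma> n t \<in> X" if "t \<in> {a n..b n}" for n t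
    using assms(4)[of n] that unfolding isocausal_curve_def top
    by (auto dest!: continuous_map_funspace)
  (* f n is the constant extension of the n-th curve, written with the clamping map c n onto
     [a n, b n]. *)
  define c where "c n s = max (a n) (min (b n) s)" for n s
  define f where "f n s = \<sigma> n (c n s)" for n s
  have c_in: "c n s \<in> {a n..b n}" for n s
    using ab by (auto simp: c_def)
  have fX: "f n s \<in> X" for n s
    using \<sigma>X c_in by (simp add: f_def)
  have \<tau>f: "\<tau> (f n s) = c n s" for n s
    using assms(5) c_in by (simp add: f_def)
  have f_le: "causal_le X d (f n s) (f n t)" if "s \<le> t" for n s t
  proof (cases "c n s = c n t")
    case True
    then show ?thesis
      by (simp add: f_def causal_le_def)
  next
    case False
    then have "c n s < c n t"
      using that by (auto simp: c_def)
    then show ?thesis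
      using assms(4)[of n] c_in unfolding isocausal_curve_def causal_less_def f_def by blast
  qed
  have f_comparable: "causal_le X d (f n s) (f n t) \<or> causal_le X d (f n t) (f n s)" for n s t
    by (cases "s \<le> t") (simp_all add: f_le)
  have equicont: "\<exists>\<delta>>0. \<forall>n s t. \<bar>s - t\<bar> < \<delta> \<longrightarrow> distinction_metric (f n s) (f n t) < \<epsilon>"
    if \<epsilon>: "\<epsilon> > 0" for \<epsilon>
  proof -
    obtain \<delta> where "\<delta> > 0" and \<delta>: "\<And>x y. \<lbrakk>x \<in> X; y \<in> X; causal_le X d x y \<or> causal_le X d y x;
        \<bar>\<tau> x - \<tau> y\<bar> < \<delta>\<rbrakk> \<Longrightarrow> distinction_metric x y < \<epsilon>"
      using distinction_small_if_time_gap_small[OF i0 \<tau> \<epsilon>] by blast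
    have "distinction_metric (f n s) (f n t) < \<epsilon>" if "\<bar>s - t\<bar> < \<delta>" for n s t
    proof (rule \<delta>[OF fX fX f_comparable])
      show "\<bar>\<tau> (f n s) - \<tau> (f n t)\<bar> < \<delta>"
        using clamp_distance_le(1)[of "a n" "b n" s t] that unfolding \<tau>f c_def by linarith
    qed
    with \<open>\<delta> > 0\<close> show ?thesis
      by blast
  qed

  (* By the parametrization the endpoints are values of tau, so all domains lie in one compact
     interval [l, u]; the limit curve is the uniform limit of the f n on it. *)
  obtain l u where lu: "\<And>x. x \<in> X \<Longrightarrow> \<tau> x \<in> {l..u}"
    using time_function_bounded[OF i0 \<tau>] by blast
  have in_box: "\<forall>n. (a n, b n) \<in> {l..u} \<times> {l..u}"
  proof
    show "(a n, b n) \<in> {l..u} \<times> {l..u}" for n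
      using lu[OF fX[of n "a n"]] lu[OF fX[of n "b n"]] ab[of n] by (simp add: \<tau>f c_def)
  qed
  have "seq_compact ({l..u} \<times> {l..u})"
    by (intro compact_imp_seq_compact compact_Times compact_Icc)
  from seq_compactE[OF this in_box] obtain p q where p: "p \<in> {l..u} \<times> {l..u}" and q: "strict_mono q"
    and lim_p: "((\<lambda>n. (a n, b n)) \<circ> q) \<longlonglongrightarrow> p"
    .
  define \<alpha> where "\<alpha> = fst p"
  define \<beta> where "\<beta> = snd p"
  have \<alpha>\<beta>: "\<alpha> \<in> {l..u}" "\<beta> \<in> {l..u}"
    using p by (auto simp: \<alpha>_def \<beta>_def)
  obtain r :: "nat \<Rightarrow> nat" and g where r: "strict_mono r" and gX: "\<And>s. s \<in> {l..u} \<Longrightarrow> g s \<in> X"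
    and g: "\<And>\<epsilon>. \<epsilon> > 0 \<Longrightarrow>
      \<forall>\<^sub>F n in sequentially. \<forall>s\<in>{l..u}. distinction_metric (f (q (r n)) s) (g s) < \<epsilon>"
  proof (rule distinction.Arzela_Ascoli_compact_target[OF compact_space_distinction[OF i0],
        of "{l..u}" "\<lambda>n. f (q n)"])
    show "\<exists>\<delta>>0. \<forall>n. \<forall>s\<in>{l..u}. \<forall>t\<in>{l..u}. dist s t < \<delta> \<longrightarrow>
        distinction_metric (f (q n) s) (f (q n) t) < \<epsilon>" if "\<epsilon> > 0" for \<epsilon>
      using equicont[OF that] unfolding dist_real_def by blast
  qed (use fX in auto)
  define k where "k = q \<circ> r"
  have k: "strict_mono k"
    using q r by (simp add: k_def strict_mono_o)
  have lim_a: "(\<lambda>n. a (k n)) \<longlonglongrightarrow> \<alpha>" and lim_b: "(\<lambda>n. b (k n)) \<longlonglongrightarrow> \<beta>"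
    using tendsto_fst[OF LIMSEQ_subseq_LIMSEQ[OF lim_p r]]
      tendsto_snd[OF LIMSEQ_subseq_LIMSEQ[OF lim_p r]]
    by (simp_all add: o_def k_def \<alpha>_def \<beta>_def)
  have "\<alpha> \<le> \<beta>"
    using LIMSEQ_le[OF lim_a lim_b] ab by blast
  then have sub: "{\<alpha>..\<beta>} \<subseteq> {l..u}"
    using \<alpha>\<beta> by auto
  have lim_f: "limitin distinction.mtopology (\<lambda>n. f (k n) t) (g t) sequentially"
    if "t \<in> {\<alpha>..\<beta>}" for t
  proof -
    have "t \<in> {l..u}"
      using that sub by blast
    then have "\<forall>\<^sub>F n in sequentially. distinction_metric (f (k n) t) (g t) < \<epsilon>"
      if "\<epsilon> > 0" for \<epsilon>
      using eventually_mono[OF g[OF that]] by (simp add: k_def)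
    then show ?thesis
      using gX fX \<open>t \<in> {l..u}\<close> by (simp add: distinction.limitin_metric)
  qed
  have lim_c: "(\<lambda>n. c (k n) t) \<longlonglongrightarrow> t" if "t \<in> {\<alpha>..\<beta>}" for t
  proof -
    have "(\<lambda>n. c (k n) t) \<longlonglongrightarrow> max \<alpha> (min \<beta> t)"
      unfolding c_def by (intro tendsto_intros lim_a lim_b)
    also have "max \<alpha> (min \<beta> t) = t"
      using that by auto
    finally show ?thesis .
  qed
  have \<tau>g: "\<tau> (g t) = t" if "t \<in> {\<alpha>..\<beta>}" for t
    using tendsto_time_function[OF i0 \<tau> lim_f[OF that]] lim_c[OF that]
    unfolding \<tau>f by (rule LIMSEQ_unique)
  have g_le: "causal_le X d (g s) (g t)" if "s \<in> {\<alpha>..\<beta>}" "t \<in> {\<alpha>..\<beta>}" "s \<le> t" for s t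
    using causal_le_limit[OF lim_f lim_f, of s t] that f_le by simp

  (* Continuity of g comes from its causal monotonicity: nearby parameters are nearby times. *)
  have "isocausal_curve X d \<alpha> \<beta> g"
    unfolding isocausal_curve_def
  proof (intro conjI ballI impI)
    show "continuous_map (top_of_set {\<alpha>..\<beta>}) (Lorentzian_topology X d) g"
      unfolding top distinction.continuous_map_to_metric
    proof (intro ballI allI impI)
      fix s \<epsilon> :: real assume "s \<in> topspace (top_of_set {\<alpha>..\<beta>})" and \<epsilon>: "\<epsilon> > 0"
      then have s: "s \<in> {\<alpha>..\<beta>}"
        by simp
      obtain \<delta> where "\<delta> > 0" and \<delta>: "\<And>x y. \<lbrakk>x \<in> X; y \<in> X; causal_le X d x y \<or> causal_le X d y x;
          \<bar>\<tau> x - \<tau> y\<bar> < \<delta>\<rbrakk> \<Longrightarrow> distinction_metric x y < \<epsilon>"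
        using distinction_small_if_time_gap_small[OF i0 \<tau> \<epsilon>] by blast
      have "g t \<in> distinction.mball (g s) \<epsilon>" if "t \<in> {\<alpha>..\<beta>} \<inter> ball s \<delta>" for t
      proof -
        have t: "t \<in> {\<alpha>..\<beta>}"
          using that by blast
        have "g s \<in> X" "g t \<in> X"
          using s t sub gX by auto
        moreover have "distinction_metric (g s) (g t) < \<epsilon>"
          using \<delta>[OF calculation] g_le[OF s t] g_le[OF t s] linear[of s t] \<tau>g[OF s] \<tau>g[OF t] that
          by (auto simp: dist_real_def)
        ultimately show ?thesis
          by simp
      qed
      then show "\<exists>U. openin (top_of_set {\<alpha>..\<beta>}) U \<and> s \<in> U \<and> (\<forall>t\<in>U. g t \<in> distinction.mball (g s) \<epsilon>)"
        using s \<open>\<delta> > 0\<close> by (intro exI[of _ "{\<alpha>..\<beta>} \<inter> ball s \<delta>"]) (auto simp: openin_open_Int)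
    qed
    show "causal_less X d (g s) (g t)" if "s \<in> {\<alpha>..\<beta>}" "t \<in> {\<alpha>..\<beta>}" "s < t" for s t
      using g_le[OF that(1,2)] that \<tau>g[of s] \<tau>g[of t] by (auto simp: causal_less_def)
  qed fact

  moreover have "curves_converge_uniformly X d (a \<circ> k) (b \<circ> k) (\<sigma> \<circ> k) \<alpha> \<beta> g"
    unfolding curves_converge_uniformly_def
  proof (intro conjI exI[of _ distinction_metric] allI impI)
    show "(a \<circ> k) \<longlonglongrightarrow> \<alpha>" "(b \<circ> k) \<longlonglongrightarrow> \<beta>"
      using lim_a lim_b by (simp_all add: o_def)
    show "Metric_space X distinction_metric"
      by (rule distinction.Metric_space_axioms)
    show "distinction.mtopology = Lorentzian_topology X d"
      using top by simp
    fix \<epsilon> :: real assume "\<epsilon> > 0"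
    then obtain \<delta> where "\<delta> > 0"
      and \<delta>: "\<And>n s t. \<bar>s - t\<bar> < \<delta> \<Longrightarrow> distinction_metric (f n s) (f n t) < \<epsilon> / 2"
      using equicont[OF half_gt_zero] by blast
    have "\<forall>\<^sub>F n in sequentially. \<bar>a (k n) - \<alpha>\<bar> < \<delta>" "\<forall>\<^sub>F n in sequentially. \<bar>b (k n) - \<beta>\<bar> < \<delta>"
      using tendstoD[OF lim_a \<open>\<delta> > 0\<close>] tendstoD[OF lim_b \<open>\<delta> > 0\<close>] by (simp_all add: dist_real_def)
    moreover have "\<forall>\<^sub>F n in sequentially. \<forall>s\<in>{l..u}. distinction_metric (f (k n) s) (g s) < \<epsilon> / 2"
      using g[OF half_gt_zero[OF \<open>\<epsilon> > 0\<close>]] by (simp add: k_def)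
    ultimately show "\<forall>\<^sub>F n in sequentially. \<forall>s. distinction_metric
        (constant_extension ((a \<circ> k) n) ((b \<circ> k) n) ((\<sigma> \<circ> k) n) s)
        (constant_extension \<alpha> \<beta> g s) < \<epsilon>"
    proof eventually_elim
      case (elim n)
      show ?case
      proof
        fix s
        define s' where "s' = max \<alpha> (min \<beta> s)"
        have "s' \<in> {\<alpha>..\<beta>}"
          using \<open>\<alpha> \<le> \<beta>\<close> by (auto simp: s'_def)
        then have s': "s' \<in> {l..u}"
          using sub by blast
        (* Moving from the clamp onto [a, b] of the n-th curve to the clamp s' onto the limit
           interval shifts the parameter by less than delta, uniformly in s. *)
        have "f (k n) (c (k n) s) = f (k n) s"
          using c_in[of "k n" s] by (simp add: f_def c_def)
        moreover have "\<bar>c (k n) s - s'\<bar> < \<delta>"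
          using clamp_distance_le(2)[of "a (k n)" "b (k n)" s \<alpha> \<beta>] elim(1,2)
          unfolding c_def s'_def by linarith
        ultimately have "distinction_metric (f (k n) s) (f (k n) s') < \<epsilon> / 2"
          using \<delta>[of "c (k n) s" s' "k n"] by simp
        moreover have "distinction_metric (f (k n) s') (g s') < \<epsilon> / 2"
          using elim(3) s' by blast
        ultimately have "distinction_metric (f (k n) s) (g s') < \<epsilon>"
          using distinction.triangle[OF fX[of "k n" s] fX[of "k n" s'] gX[OF s']] by linarith
        then show "distinction_metric
            (constant_extension ((a \<circ> k) n) ((b \<circ> k) n) ((\<sigma> \<circ> k) n) s)
            (constant_extension \<alpha> \<beta> g s) < \<epsilon>"
          using ab \<open>\<alpha> \<le> \<beta>\<close> by (simp add: constant_extension_eq_clamp f_def c_def s'_def)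
      qed
    qed
  qed

  moreover have "maximizing_curve d \<alpha> \<beta> g" if max: "\<forall>n. maximizing_curve d (a n) (b n) (\<sigma> n)"
    unfolding maximizing_curve_def
  proof (intro ballI impI)
    fix t t' t'' assume t: "t \<in> {\<alpha>..\<beta>}" "t' \<in> {\<alpha>..\<beta>}" "t'' \<in> {\<alpha>..\<beta>}" and "t < t' \<and> t' < t''"
    (* The parameters may lie outside the domain of the n-th curve; after clamping they are still
       strictly ordered for large n. *)
    have "\<forall>\<^sub>F n in sequentially. c (k n) t < c (k n) t'"
      "\<forall>\<^sub>F n in sequentially. c (k n) t' < c (k n) t''"
      using order_tendstoD(1)[OF tendsto_diff[OF lim_c lim_c], of _ _ 0] t \<open>t < t' \<and> t' < t''\<close>
      by auto
    then have "\<forall>\<^sub>F n in sequentially.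
        d (f (k n) t) (f (k n) t') + d (f (k n) t') (f (k n) t'') = d (f (k n) t) (f (k n) t'')"
    proof eventually_elim
      case (elim n)
      then show ?case
        using max c_in[of "k n"] unfolding maximizing_curve_def f_def by blast
    qed
    moreover have "(\<lambda>n. d (f (k n) t) (f (k n) t') + d (f (k n) t') (f (k n) t''))
        \<longlonglongrightarrow> d (g t) (g t') + d (g t') (g t'')"
      using t by (intro tendsto_add tendsto_d_distinction lim_f)
    ultimately have "(\<lambda>n. d (f (k n) t) (f (k n) t'')) \<longlonglongrightarrow> d (g t) (g t') + d (g t') (g t'')"
      by (simp add: tendsto_cong)
    then show "d (g t) (g t') + d (g t') (g t'') = d (g t) (g t'')"
      using tendsto_d_distinction[OF lim_f[OF t(1)] lim_f[OF t(3)]] by (rule LIMSEQ_unique)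
  qed
  ultimately show ?thesis
    using k by blast
qed

end
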